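(* Let $H$ be a graph with vertex set $\{1,\dots,p\}$, let $m=(m_1,\dots,m_p)\in\mathbb{Z}_{\ge 0}^p$, and let $n=\sum_{i=1}^p m_i$. Then $A(H[m])=1$ when $n=1$, and for $n\ge 2$ \[ A(H[m])=\sum_{i\,:\,m_i>0}\frac{m_i\,A(H[m-e_i])}{\binom{n-1}{\sum_{j\sim i}m_j}}, \] where $e_i$ is the $i$-th standard basis vector and $j\sim i$ means that $ij$ is an edge of $H$.
   Context: Graphs are finite, simple and undirected. Uniform sequential attachment process: $G_1=K_1$, and for $t\ge 2$ the random graph $G_t$ is obtained from $G_{t-1}$ (which has $t-1$ vertices) as follows: choose $k$ uniformly from $\{0,1,\dots,t-1\}$, then choose a $k$-element subset $W$ of $V(G_{t-1})$ uniformly at random, then add a new vertex adjacent to exactly the vertices of $W$; all choices are independent across steps. For a graph $G$ on $n$ vertices, its likelihood is $\mathcal{L}(G)=\Pr[G_n\cong G]$, and $A(G)=n!\,|\mathrm{Aut}(G)|\,\mathcal{L}(G)$, where $\mathrm{Aut}(G)$ is the automorphism group of $G$. The blow-up $H[m]$ is the graph obtained from $H$ by replacing each vertex $i$ by an independent set $V_i$ of size $m_i$ (possibly empty) and joining $V_i$ to $V_j$ completely whenever $ij\in E(H)$, with no other edges. *)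

theory Defs
  imports "HOL-Probability.Probability" "HOL-Combinatorics.Permutations"
begin

record 'a ugraph =
  verts :: "'a set"
  edges :: "'a set set"

definition simple_graph :: "'a ugraph \<Rightarrow> bool" where
  "simple_graph G \<longleftrightarrow> finite (verts G) \<and> (\<forall>e\<in>edges G. e \<subseteq> verts G \<and> card e = 2)"

definition adjacent :: "'a ugraph \<Rightarrow> 'a \<Rightarrow> 'a \<Rightarrow> bool" where
  "adjacent G u v \<longleftrightarrow> {u, v} \<in> edges G"

definition graph_iso :: "'a ugraph \<Rightarrow> 'b ugraph \<Rightarrow> bool" where
  "graph_iso G H \<longleftrightarrow> (\<exists>f. bij_betw f (verts G) (verts H) \<and>
     (\<forall>u\<in>verts G. \<forall>v\<in>verts G. adjacent G u v \<longleftrightarrow> adjacent H (f u) (f v)))"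

text \<open>Requiring \<open>f permutes verts G\<close> fixes the values of \<open>f\<close> outside the vertex set, so every
  automorphism is represented by exactly one function and \<open>card (Aut G)\<close> is the group order.\<close>

definition Aut :: "'a ugraph \<Rightarrow> ('a \<Rightarrow> 'a) set" where
  "Aut G = {f. f permutes verts G \<and>
     (\<forall>u\<in>verts G. \<forall>v\<in>verts G. adjacent G u v \<longleftrightarrow> adjacent G (f u) (f v))}"

definition attach_vertex :: "'a \<Rightarrow> 'a set \<Rightarrow> 'a ugraph \<Rightarrow> 'a ugraph" where
  "attach_vertex x W G =
     \<lparr>verts = insert x (verts G), edges = edges G \<union> {{x, w} | w. w \<in> W}\<rparr>"

text \<open>\<open>attachment_process t\<close> is the distribution of the random graph \<open>G\<^sub>t\<close>, realised on the
  vertex set \<open>{1..t}\<close>. The process starts at \<open>t = 1\<close>; the value at \<open>0\<close> is only a convention.\<close>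

fun attachment_process :: "nat \<Rightarrow> nat ugraph pmf" where
  "attachment_process 0 = return_pmf \<lparr>verts = {}, edges = {}\<rparr>"
| "attachment_process (Suc 0) = return_pmf \<lparr>verts = {1}, edges = {}\<rparr>"
| "attachment_process (Suc (Suc s)) =
     bind_pmf (attachment_process (Suc s)) (\<lambda>G.
     bind_pmf (pmf_of_set {0..Suc s}) (\<lambda>k.
     bind_pmf (pmf_of_set {W. W \<subseteq> verts G \<and> card W = k}) (\<lambda>W.
     return_pmf (attach_vertex (Suc (Suc s)) W G))))"

definition likelihood :: "'a ugraph \<Rightarrow> real" where
  "likelihood G =
     measure_pmf.prob (attachment_process (card (verts G))) {X. graph_iso X G}"

definition A :: "'a ugraph \<Rightarrow> real" where
  "A G = fact (card (verts G)) * real (card (Aut G)) * likelihood G"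

text \<open>The independent set replacing vertex \<open>i\<close> is \<open>{i} \<times> {..<m i}\<close>. Only the values of \<open>m\<close> on
  \<open>verts H\<close> matter.\<close>

definition blowup :: "'a ugraph \<Rightarrow> ('a \<Rightarrow> nat) \<Rightarrow> ('a \<times> nat) ugraph" where
  "blowup H m =
     \<lparr>verts = (SIGMA i:verts H. {..<m i}),
      edges = {{(i, a), (j, b)} | i a j b.
        i \<in> verts H \<and> j \<in> verts H \<and> a < m i \<and> b < m j \<and> adjacent H i j}\<rparr>"

end

theory Submission imports Defs begin

text \<open>
  The likelihood of \<open>G\<close> times \<open>|Aut G|\<close> is the expected number of isomorphisms from the random graph
  \<open>G\<^sub>n\<close> to \<open>G\<close>, because a graph isomorphic to \<open>G\<close> has exactly \<open>|Aut G|\<close> isomorphisms to it and any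
  other graph has none (\<open>card_isos_eq_Aut\<close>). This turns \<open>A G\<close> into \<open>n!\<close> times an expected count
  (\<open>A_eq_expected_isos\<close>), and counts, unlike isomorphism classes, are easy to decompose.

  An isomorphism from \<open>G\<^sub>n\<close> to \<open>G\<close> is determined by the image \<open>v\<close> of the last vertex together with
  an isomorphism \<open>g\<close> from \<open>G\<^sub>n\<^sub>-\<^sub>1\<close> to \<open>G - v\<close>. Conversely, a pair \<open>(v, g)\<close> arises from exactly one
  attachment set \<open>W\<close>, the preimage under \<open>g\<close> of the neighbourhood of \<open>v\<close>; the process selects this
  \<open>W\<close> with probability \<open>1 / (n * (n - 1 choose deg v))\<close>. Summing over all pairs and cancelling the
  factor \<open>n\<close> against \<open>n!\<close> gives, for an arbitrary graph,
  \<open>A G = (\<Sum>v. A (G - v) / (n - 1 choose deg v))\<close>; this is \<open>A_vertex_deletion\<close>.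

  In a blow-up, the \<open>m i\<close> vertices replacing vertex \<open>i\<close> all have degree \<open>\<Sum>j\<sim>i. m j\<close>, and deleting any
  one of them leaves a copy of the blow-up with \<open>m i\<close> decreased by one. As \<open>A\<close> is invariant under
  isomorphism, collecting equal terms yields the recurrence.
\<close>

section \<open>Counting isomorphisms\<close>

lemma adjacent_commute: "adjacent G u v \<longleftrightarrow> adjacent G v u"
  by (simp add: adjacent_def insert_commute)

lemma simple_graph_adjacentD:
  assumes "simple_graph G" and "adjacent G u v"
  shows "u \<in> verts G" and "v \<in> verts G" and "u \<noteq> v"
  using assms by (fastforce simp: simple_graph_def adjacent_def)+

lemma verts_attach_vertex: "verts (attach_vertex x W G) = insert x (verts G)"
  by (simp add: attach_vertex_def)

lemma adjacent_attach_vertex: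
  "adjacent (attach_vertex x W G) u v \<longleftrightarrow>
     adjacent G u v \<or> u = x \<and> v \<in> W \<or> v = x \<and> u \<in> W"
  by (auto simp: adjacent_def attach_vertex_def doubleton_eq_iff)

text \<open>Restricting to extensional functions represents each isomorphism once, so that cardinalities
  are meaningful.\<close>

definition isos :: "'a ugraph \<Rightarrow> 'b ugraph \<Rightarrow> ('a \<Rightarrow> 'b) set" where
  "isos G H = {f \<in> extensional (verts G). bij_betw f (verts G) (verts H) \<and>
     (\<forall>u\<in>verts G. \<forall>v\<in>verts G. adjacent G u v \<longleftrightarrow> adjacent H (f u) (f v))}"

lemma finite_isos:
  assumes "finite (verts G)" and "finite (verts H)"
  shows "finite (isos G H)"
proof (rule finite_subset)
  show "isos G H \<subseteq> verts G \<rightarrow>\<^sub>E verts H"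
    by (auto simp: isos_def PiE_def bij_betw_def)
qed (use assms in \<open>auto intro: finite_PiE\<close>)

lemma graph_iso_iff_isos: "graph_iso G H \<longleftrightarrow> isos G H \<noteq> {}"
proof
  assume "graph_iso G H"
  then obtain f where "bij_betw f (verts G) (verts H)"
    and "\<forall>u\<in>verts G. \<forall>v\<in>verts G. adjacent G u v \<longleftrightarrow> adjacent H (f u) (f v)"
    by (auto simp: graph_iso_def)
  then have "restrict f (verts G) \<in> isos G H"
    by (auto simp: isos_def)
  then show "isos G H \<noteq> {}" by blast
qed (auto simp: isos_def graph_iso_def)

lemma graph_iso_refl: "graph_iso G G"
  unfolding graph_iso_def by (rule exI[of _ id]) auto

lemma graph_iso_sym:
  assumes "graph_iso G H" shows "graph_iso H G"
proof -
  from assms obtain f where f: "bij_betw f (verts G) (verts H)"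
    and adj: "\<forall>u\<in>verts G. \<forall>v\<in>verts G. adjacent G u v \<longleftrightarrow> adjacent H (f u) (f v)"
    by (auto simp: graph_iso_def)
  let ?g = "inv_into (verts G) f"
  have g: "bij_betw ?g (verts H) (verts G)" by (rule bij_betw_inv_into[OF f])
  have fg: "f (?g y) = y" if "y \<in> verts H" for y
    using bij_betw_inv_into_right[OF f that] .
  show ?thesis unfolding graph_iso_def
    using g fg adj bij_betwE[OF g] by (intro exI[of _ ?g]) auto
qed

text \<open>Composing with fixed isomorphisms on both sides is injective. The inequality suffices for
  equality, since isomorphy is symmetric.\<close>

lemma card_isos_le:
  assumes "graph_iso G' G" and "graph_iso H H'"
    and fin: "finite (verts G')" "finite (verts H')"
  shows "card (isos G H) \<le> card (isos G' H')"
proof -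
  from assms(1) obtain p where p: "bij_betw p (verts G') (verts G)"
    and padj: "\<forall>u\<in>verts G'. \<forall>v\<in>verts G'. adjacent G' u v \<longleftrightarrow> adjacent G (p u) (p v)"
    by (auto simp: graph_iso_def)
  from assms(2) obtain q where q: "bij_betw q (verts H) (verts H')"
    and qadj: "\<forall>u\<in>verts H. \<forall>v\<in>verts H. adjacent H u v \<longleftrightarrow> adjacent H' (q u) (q v)"
    by (auto simp: graph_iso_def)
  let ?c = "\<lambda>f. restrict (q \<circ> f \<circ> p) (verts G')"
  show ?thesis
  proof (rule card_inj_on_le[of ?c])
    show "?c ` isos G H \<subseteq> isos G' H'"
    proof (rule image_subsetI)
      fix f assume "f \<in> isos G H"
      then have f: "bij_betw f (verts G) (verts H)"
        and fadj: "\<forall>u\<in>verts G. \<forall>v\<in>verts G. adjacent G u v \<longleftrightarrow> adjacent H (f u) (f v)"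
        by (auto simp: isos_def)
      have "bij_betw (q \<circ> f \<circ> p) (verts G') (verts H')"
        using bij_betw_trans[OF p bij_betw_trans[OF f q]] by (simp add: comp_assoc)
      then show "?c f \<in> isos G' H'"
        using padj fadj qadj bij_betwE[OF p] bij_betwE[OF f] by (auto simp: isos_def)
    qed
    show "inj_on ?c (isos G H)"
    proof (rule inj_onI)
      fix f g assume fg: "f \<in> isos G H" "g \<in> isos G H" and eq: "?c f = ?c g"
      have fv: "f y \<in> verts H" "g y \<in> verts H" if "y \<in> verts G" for y
        using fg that by (auto simp: isos_def bij_betw_def)
      show "f = g"
      proof (rule extensionalityI[of _ "verts G"])
        fix y assume "y \<in> verts G"
        then obtain x where x: "x \<in> verts G'" "y = p x"
          using p by (auto simp: bij_betw_def)
        have "q (f y) = q (g y)" using fun_cong[OF eq, of x] x by simp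
        then show "f y = g y"
          using q fv[OF \<open>y \<in> verts G\<close>] by (auto simp: bij_betw_def dest: inj_onD)
      qed (use fg in \<open>auto simp: isos_def\<close>)
    qed
  qed (rule finite_isos[OF fin])
qed

lemma card_isos_cong:
  assumes "graph_iso G G'" and "graph_iso H H'"
    and "finite (verts G)" and "finite (verts H)"
    and "finite (verts G')" and "finite (verts H')"
  shows "card (isos G H) = card (isos G' H')"
  using assms by (intro antisym card_isos_le) (auto intro: graph_iso_sym)

text \<open>Automorphisms are the identity off the vertex set, elements of \<open>isos G G\<close> are undefined there;
  changing the default value translates between the two.\<close>

lemma card_Aut: "card (Aut G) = card (isos G G)"
proof (rule bij_betw_same_card)
  show "bij_betw (\<lambda>f. restrict f (verts G)) (Aut G) (isos G G)"
  proof (rule bij_betw_byWitness[where f' = "\<lambda>f y. if y \<in> verts G then f y else y"])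
    show "(\<lambda>f y. if y \<in> verts G then f y else y) ` isos G G \<subseteq> Aut G"
    proof (rule image_subsetI)
      fix f assume f: "f \<in> isos G G"
      have "bij_betw (\<lambda>y. if y \<in> verts G then f y else y) (verts G) (verts G)"
        using f by (auto simp: isos_def cong: bij_betw_cong)
      then have "(\<lambda>y. if y \<in> verts G then f y else y) permutes verts G"
        by (rule bij_imp_permutes) auto
      then show "(\<lambda>y. if y \<in> verts G then f y else y) \<in> Aut G"
        using f by (auto simp: Aut_def isos_def)
    qed
    show "(\<lambda>f. restrict f (verts G)) ` Aut G \<subseteq> isos G G"
      by (auto simp: Aut_def isos_def permutes_imp_bij)
  qed (auto simp: Aut_def isos_def permutes_not_in extensional_def fun_eq_iff)
qed

text \<open>If \<open>X\<close> is isomorphic to \<open>G\<close>, then replacing \<open>X\<close> by \<open>G\<close> does not change the number of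
  isomorphisms to \<open>G\<close>, and the isomorphisms from \<open>G\<close> to itself are its automorphisms.\<close>

lemma card_isos_eq_Aut:
  assumes "finite (verts X)" and "finite (verts G)"
  shows "real (card (isos X G)) = real (card (Aut G)) * indicator {X. graph_iso X G} X"
  using assms card_isos_cong[OF _ graph_iso_refl, of X G G]
  by (auto simp: card_Aut graph_iso_iff_isos indicator_def)

section \<open>The invariant as an expected number of isomorphisms\<close>

lemma set_pmf_attachment_process:
  assumes "X \<in> set_pmf (attachment_process n)"
  shows "verts X = {1..n} \<and> simple_graph X"
  using assms
proof (induction n arbitrary: X rule: attachment_process.induct)
  case (3 s)
  have fin: "finite {W. W \<subseteq> {1..Suc s} \<and> card W = k}" for k
    by simp
  have ne: "{W. W \<subseteq> {1..Suc s} \<and> card W = k} \<noteq> {}" if "k \<le> Suc s" for k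
    using obtain_subset_with_card_n[of k "{1..Suc s}"] that by auto
  from 3 obtain G W where G: "verts G = {1..Suc s}" "simple_graph G"
    and W: "W \<subseteq> {1..Suc s}" and X: "X = attach_vertex (Suc (Suc s)) W G"
    using fin ne by fastforce
  have "verts X = {1..Suc (Suc s)}"
    using G by (auto simp: X attach_vertex_def)
  moreover have "simple_graph X"
    using G W by (fastforce simp: X attach_vertex_def simple_graph_def card_insert_if)
  ultimately show ?case by blast
qed (auto simp: simple_graph_def)

lemma finite_set_pmf_attachment_process: "finite (set_pmf (attachment_process n))"
proof (rule finite_subset)
  show "set_pmf (attachment_process n) \<subseteq>
      (\<lambda>E. \<lparr>verts = {1..n}, edges = E\<rparr>) ` Pow (Pow {1..n})"
  proof
    fix X assume "X \<in> set_pmf (attachment_process n)"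
    then have "verts X = {1..n}" "edges X \<subseteq> Pow {1..n}"
      using set_pmf_attachment_process[of X n] by (auto simp: simple_graph_def)
    moreover have "X = \<lparr>verts = verts X, edges = edges X\<rparr>" by simp
    ultimately show "X \<in> (\<lambda>E. \<lparr>verts = {1..n}, edges = E\<rparr>) ` Pow (Pow {1..n})"
      by (metis (no_types) PowI image_eqI)
  qed
qed simp

definition expected_isos :: "nat \<Rightarrow> 'a ugraph \<Rightarrow> real" where
  "expected_isos n G =
     measure_pmf.expectation (attachment_process n) (\<lambda>X. real (card (isos X G)))"

lemma A_eq_expected_isos:
  assumes "finite (verts G)"
  shows "A G = fact (card (verts G)) * expected_isos (card (verts G)) G"
proof -
  let ?M = "attachment_process (card (verts G))"
  have "expected_isos (card (verts G)) G =
      measure_pmf.expectation ?M (\<lambda>X. real (card (Aut G)) * indicator {X. graph_iso X G} X)"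
    unfolding expected_isos_def
  proof (rule integral_cong_AE)
    show "AE X in ?M. real (card (isos X G)) =
        real (card (Aut G)) * indicator {X. graph_iso X G} X"
    proof (rule AE_pmfI)
      fix X assume "X \<in> set_pmf ?M"
      then have "finite (verts X)" using set_pmf_attachment_process[of X] by auto
      then show "real (card (isos X G)) =
          real (card (Aut G)) * indicator {X. graph_iso X G} X"
        using assms by (rule card_isos_eq_Aut)
    qed
  qed simp_all
  also have "\<dots> = real (card (Aut G)) * likelihood G"
    by (simp add: likelihood_def)
  finally show ?thesis by (simp add: A_def)
qed

lemma A_cong_graph_iso:
  assumes "graph_iso G G'" and "finite (verts G)" and "finite (verts G')"
  shows "A G = A G'"
proof -
  have card: "card (verts G) = card (verts G')"
    using assms(1) by (auto simp: graph_iso_def dest: bij_betw_same_card)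
  have "expected_isos n G = expected_isos n G'" for n
    unfolding expected_isos_def
  proof (rule integral_cong_AE)
    show "AE X in attachment_process n. real (card (isos X G)) = real (card (isos X G'))"
    proof (rule AE_pmfI)
      fix X assume "X \<in> set_pmf (attachment_process n)"
      then have "finite (verts X)" using set_pmf_attachment_process[of X] by auto
      then show "real (card (isos X G)) = real (card (isos X G'))"
        using assms card_isos_cong[OF graph_iso_refl, of G G' X] by simp
    qed
  qed simp_all
  then show ?thesis using assms card by (simp add: A_eq_expected_isos)
qed

section \<open>Isomorphisms from a graph with an attached vertex\<close>

definition delete_vertex :: "'a \<Rightarrow> 'a ugraph \<Rightarrow> 'a ugraph" where
  "delete_vertex v G = \<lparr>verts = verts G - {v}, edges = {e \<in> edges G. v \<notin> e}\<rparr>"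

lemma verts_delete_vertex [simp]: "verts (delete_vertex v G) = verts G - {v}"
  by (simp add: delete_vertex_def)

lemma adjacent_delete_vertex:
  "adjacent (delete_vertex v G) u w \<longleftrightarrow> adjacent G u w \<and> u \<noteq> v \<and> w \<noteq> v"
  by (auto simp: adjacent_def delete_vertex_def)

definition neighbours :: "'a ugraph \<Rightarrow> 'a \<Rightarrow> 'a set" where
  "neighbours G v = {w \<in> verts G. adjacent G v w}"

text \<open>One direction of the correspondence \<open>(W, f) \<leftrightarrow> (v, g)\<close>. The third part shows that \<open>W\<close> can be
  recovered from the pair \<open>(v, g)\<close>, the last one that \<open>|W|\<close> is the degree of \<open>v\<close>, and hence that the
  probability of \<open>W\<close> depends on \<open>v\<close> alone.\<close>

lemma restrict_isos_attach_vertex: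
  assumes X: "simple_graph X" and x: "x \<notin> verts X" and W: "W \<subseteq> verts X"
    and f: "f \<in> isos (attach_vertex x W X) G"
  shows "f x \<in> verts G"
    and "restrict f (verts X) \<in> isos X (delete_vertex (f x) G)"
    and "{u \<in> verts X. adjacent G (f x) (f u)} = W"
    and "bij_betw f W (neighbours G (f x) - {f x})"
proof -
  have f_bij: "bij_betw f (insert x (verts X)) (verts G)"
    and f_adj: "\<And>u v. u \<in> insert x (verts X) \<Longrightarrow> v \<in> insert x (verts X) \<Longrightarrow>
      adjacent (attach_vertex x W X) u v \<longleftrightarrow> adjacent G (f u) (f v)"
    using f by (auto simp: isos_def verts_attach_vertex)
  show fx: "f x \<in> verts G" using f_bij by (auto simp: bij_betw_def)
  have bij: "bij_betw f (verts X) (verts G - {f x})"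
    using f_bij x by (auto simp: bij_betw_def) (metis image_eqI)
  have "f u \<noteq> f x" if "u \<in> verts X" for u using bij that by (auto simp: bij_betw_def)
  then show "restrict f (verts X) \<in> isos X (delete_vertex (f x) G)"
    using bij f_adj x by (auto simp: isos_def adjacent_delete_vertex adjacent_attach_vertex)
  have "adjacent G (f x) (f u) \<longleftrightarrow> u \<in> W" if "u \<in> verts X" for u
  proof -
    have "\<not> adjacent X x u" using simple_graph_adjacentD(1)[OF X] x by blast
    moreover have "u \<noteq> x" using x that by blast
    ultimately have "adjacent (attach_vertex x W X) x u \<longleftrightarrow> u \<in> W"
      by (simp add: adjacent_attach_vertex)
    then show ?thesis using f_adj[of x u] that by simp
  qed
  then show pre: "{u \<in> verts X. adjacent G (f x) (f u)} = W" using W by auto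
  have "f ` W = neighbours G (f x) - {f x}"
    unfolding pre[symmetric] neighbours_def using bij by (auto simp: bij_betw_def)
  then show "bij_betw f W (neighbours G (f x) - {f x})"
    using inj_on_subset[OF bij_betw_imp_inj_on[OF bij] W] by (simp add: bij_betw_def)
qed

lemma extend_isos_delete_vertex:
  assumes X: "simple_graph X" and G: "simple_graph G"
    and x: "x \<notin> verts X" and v: "v \<in> verts G"
    and g: "g \<in> isos X (delete_vertex v G)"
  shows "g(x := v) \<in> isos (attach_vertex x {u \<in> verts X. adjacent G v (g u)} X) G"
proof -
  have g_ext: "g \<in> extensional (verts X)"
    and g_bij: "bij_betw g (verts X) (verts G - {v})"
    and g_adj: "\<And>u w. u \<in> verts X \<Longrightarrow> w \<in> verts X \<Longrightarrow>
      adjacent X u w \<longleftrightarrow> adjacent (delete_vertex v G) (g u) (g w)"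
    using g by (auto simp: isos_def)
  have gv: "g u \<noteq> v" if "u \<in> verts X" for u using g_bij that by (auto simp: bij_betw_def)
  have "bij_betw (g(x := v)) (verts X) (verts G - {v})"
    using g_bij x bij_betw_cong[of "verts X" "g(x := v)" g] by fastforce
  then have "bij_betw (g(x := v)) (insert x (verts X)) (insert v (verts G - {v}))"
    using x v by (auto simp: bij_betw_def)
  moreover have "insert v (verts G - {v}) = verts G" using v by auto
  moreover have "\<not> adjacent G v v" using simple_graph_adjacentD[OF G] by blast
  moreover have "\<not> adjacent X x u" "\<not> adjacent X u x" for u
    using simple_graph_adjacentD[OF X] x by blast+
  ultimately show ?thesis
    using g_ext g_adj gv x adjacent_commute[of G]
    by (auto simp: isos_def verts_attach_vertex extensional_def
        adjacent_attach_vertex adjacent_delete_vertex)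
qed

text \<open>Both sides count pairs: \<open>(W, f)\<close> on the left and \<open>(v, g)\<close> on the right, with weights that agree
  because the attachment set is as large as the neighbourhood of the image of \<open>x\<close>.\<close>

lemma sum_isos_attach_vertex:
  assumes X: "simple_graph X" and G: "simple_graph G" and x: "x \<notin> verts X"
  shows "(\<Sum>W\<in>Pow (verts X). real (card (isos (attach_vertex x W X) G)) / c (card W)) =
    (\<Sum>v\<in>verts G. real (card (isos X (delete_vertex v G))) / c (card (neighbours G v)))"
proof -
  have fin: "finite (verts X)" "finite (verts G)" using X G by (auto simp: simple_graph_def)
  have irr: "neighbours G v - {v} = neighbours G v" for v
    using simple_graph_adjacentD(3)[OF G, of v v] by (auto simp: neighbours_def)
  have "(\<Sum>W\<in>Pow (verts X). real (card (isos (attach_vertex x W X) G)) / c (card W)) =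
      (\<Sum>W\<in>Pow (verts X). \<Sum>f\<in>isos (attach_vertex x W X) G. 1 / c (card W))"
    by simp
  also have "\<dots> = (\<Sum>(W, f)\<in>(SIGMA W:Pow (verts X). isos (attach_vertex x W X) G). 1 / c (card W))"
    using fin by (intro sum.Sigma) (auto intro!: finite_isos simp: verts_attach_vertex)
  also have "\<dots> = (\<Sum>(v, g)\<in>(SIGMA v:verts G. isos X (delete_vertex v G)).
      1 / c (card (neighbours G v)))"
  proof (rule sum.reindex_bij_witness[where
        j = "\<lambda>(W, f). (f x, restrict f (verts X))" and
        i = "\<lambda>(v, g). ({u \<in> verts X. adjacent G v (g u)}, g(x := v))"])
    fix a assume a: "a \<in> (SIGMA W:Pow (verts X). isos (attach_vertex x W X) G)"
    obtain W f where af: "a = (W, f)" by force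
    have W: "W \<subseteq> verts X" and f: "f \<in> isos (attach_vertex x W X) G" using a af by auto
    note r = restrict_isos_attach_vertex[OF X x W f]
    have "f \<in> extensional (insert x (verts X))"
      using f by (auto simp: isos_def verts_attach_vertex)
    then have ext: "(restrict f (verts X))(x := f x) = f"
      by (auto simp: fun_eq_iff extensional_def)
    have "{u \<in> verts X. adjacent G (f x) (restrict f (verts X) u)} = W"
      using r(3) by auto
    then show "(case case a of (W, f) \<Rightarrow> (f x, restrict f (verts X)) of
        (v, g) \<Rightarrow> ({u \<in> verts X. adjacent G v (g u)}, g(x := v))) = a"
      using ext by (simp add: af)
    show "(case a of (W, f) \<Rightarrow> (f x, restrict f (verts X)))
        \<in> (SIGMA v:verts G. isos X (delete_vertex v G))"
      using r(1,2) by (simp add: af)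
    have "card W = card (neighbours G (f x))"
      using bij_betw_same_card[OF r(4)] irr by simp
    then show "(case case a of (W, f) \<Rightarrow> (f x, restrict f (verts X)) of
        (v, g) \<Rightarrow> 1 / c (card (neighbours G v))) = (case a of (W, f) \<Rightarrow> 1 / c (card W))"
      by (simp add: af)
  next
    fix b assume b: "b \<in> (SIGMA v:verts G. isos X (delete_vertex v G))"
    obtain v g where bg: "b = (v, g)" by force
    have v: "v \<in> verts G" and g: "g \<in> isos X (delete_vertex v G)" using b bg by auto
    have "restrict (g(x := v)) (verts X) = g"
      using g x by (auto simp: isos_def fun_eq_iff extensional_def)
    then show "(case case b of (v, g) \<Rightarrow> ({u \<in> verts X. adjacent G v (g u)}, g(x := v)) of
        (W, f) \<Rightarrow> (f x, restrict f (verts X))) = b"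
      by (simp add: bg)
    show "(case b of (v, g) \<Rightarrow> ({u \<in> verts X. adjacent G v (g u)}, g(x := v)))
        \<in> (SIGMA W:Pow (verts X). isos (attach_vertex x W X) G)"
      using extend_isos_delete_vertex[OF X G x v g] by (auto simp: bg)
  qed
  also have "\<dots> = (\<Sum>v\<in>verts G. \<Sum>g\<in>isos X (delete_vertex v G). 1 / c (card (neighbours G v)))"
    using fin by (intro sum.Sigma[symmetric]) (auto intro!: finite_isos)
  finally show ?thesis by simp
qed

section \<open>The vertex-deletion recurrence\<close>

text \<open>Choosing first a size and then a set of that size gives each \<open>W\<close> probability
  \<open>1 / ((n + 1) * (n choose |W|))\<close>, where \<open>n + 1\<close> counts the possible sizes.\<close>

lemma expectation_attachment_step:
  fixes h :: "nat ugraph \<Rightarrow> real"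
  assumes V: "finite V" "card V = n"
  shows "measure_pmf.expectation
      (bind_pmf (pmf_of_set {0..n}) (\<lambda>k.
       bind_pmf (pmf_of_set {W. W \<subseteq> V \<and> card W = k}) (\<lambda>W. return_pmf (F W)))) h =
    (\<Sum>W\<in>Pow V. h (F W) / real (n choose card W)) / real (Suc n)"
proof -
  have fin: "finite {W. W \<subseteq> V \<and> card W = k}" for k using V by simp
  have crd: "card {W. W \<subseteq> V \<and> card W = k} = n choose k" for k
    using n_subsets[OF V(1), of k] V(2) by simp
  have ne: "{W. W \<subseteq> V \<and> card W = k} \<noteq> {}" if "k \<le> n" for k
    using obtain_subset_with_card_n[of k V] that V by auto
  have inner: "measure_pmf.expectation (bind_pmf (pmf_of_set {W. W \<subseteq> V \<and> card W = k})
        (\<lambda>W. return_pmf (F W))) h =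
      (\<Sum>W\<in>{W \<in> Pow V. card W = k}. h (F W) / real (n choose card W))" if "k \<le> n" for k
  proof -
    have "measure_pmf.expectation (bind_pmf (pmf_of_set {W. W \<subseteq> V \<and> card W = k})
          (\<lambda>W. return_pmf (F W))) h =
        (\<Sum>W\<in>{W. W \<subseteq> V \<and> card W = k}. h (F W) /\<^sub>R real (n choose k))"
      using ne[OF that] fin[of k] by (subst pmf_expectation_bind_pmf_of_set) (auto simp: crd)
    also have "\<dots> = (\<Sum>W\<in>{W \<in> Pow V. card W = k}. h (F W) / real (n choose card W))"
      by (intro sum.cong) (auto simp: field_simps)
    finally show ?thesis .
  qed
  have "measure_pmf.expectation
      (bind_pmf (pmf_of_set {0..n}) (\<lambda>k.
       bind_pmf (pmf_of_set {W. W \<subseteq> V \<and> card W = k}) (\<lambda>W. return_pmf (F W)))) h =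
    (\<Sum>k\<in>{0..n}. measure_pmf.expectation (bind_pmf (pmf_of_set {W. W \<subseteq> V \<and> card W = k})
        (\<lambda>W. return_pmf (F W))) h /\<^sub>R real (card {0..n}))"
  proof (rule pmf_expectation_bind_pmf_of_set)
    fix k assume "k \<in> {0..n}"
    then show "finite (set_pmf (bind_pmf (pmf_of_set {W. W \<subseteq> V \<and> card W = k})
        (\<lambda>W. return_pmf (F W))))"
      using ne[of k] fin[of k] by auto
  qed auto
  also have "\<dots> = (\<Sum>k\<in>{0..n}. \<Sum>W\<in>{W \<in> Pow V. card W = k}.
      h (F W) / real (n choose card W)) / real (Suc n)"
    unfolding sum_divide_distrib[of _ "{0..n}"]
    by (intro sum.cong refl) (simp add: inner divide_inverse)
  also have "(\<Sum>k\<in>{0..n}. \<Sum>W\<in>{W \<in> Pow V. card W = k}. h (F W) / real (n choose card W)) =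
      (\<Sum>W\<in>Pow V. h (F W) / real (n choose card W))"
    using V by (intro sum.group) (auto intro: card_mono)
  finally show ?thesis .
qed

text \<open>Conditioning on the graph \<open>X\<close> before the last step reduces this to a sum over attachment sets for
  each fixed \<open>X\<close>. The process has finite support, so expectations are finite sums and can be
  interchanged with the sum over \<open>v\<close>.\<close>

lemma expected_isos_Suc:
  assumes G: "simple_graph G" and n: "n \<ge> 1"
  shows "expected_isos (Suc n) G =
    (\<Sum>v\<in>verts G. expected_isos n (delete_vertex v G) / real (n choose card (neighbours G v)))
      / real (Suc n)"
proof -
  obtain s where s: "n = Suc s" using n by (cases n) auto
  let ?P = "attachment_process n" and ?S = "set_pmf (attachment_process n)"
  let ?step = "\<lambda>X. bind_pmf (pmf_of_set {0..n}) (\<lambda>k.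
     bind_pmf (pmf_of_set {W. W \<subseteq> verts X \<and> card W = k}) (\<lambda>W.
     return_pmf (attach_vertex (Suc n) W X)))"
  have expand: "measure_pmf.expectation ?P h = (\<Sum>X\<in>?S. pmf ?P X * h X)" for h :: "_ \<Rightarrow> real"
    using integral_measure_pmf[OF finite_set_pmf_attachment_process, of ?P h]
    by simp
  have fin_step: "finite (set_pmf (?step X))" if "X \<in> ?S" for X
  proof -
    have V: "verts X = {1..n}" using set_pmf_attachment_process[OF that] by simp
    have "{W. W \<subseteq> {1..n} \<and> card W = k} \<noteq> {}" if "k \<le> n" for k
      using obtain_subset_with_card_n[of k "{1..n}"] that by auto
    then show ?thesis by (auto simp: V)
  qed
  have "expected_isos (Suc n) G =
      measure_pmf.expectation (bind_pmf ?P ?step) (\<lambda>X. real (card (isos X G)))"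
    by (simp add: expected_isos_def s)
  also have "\<dots> = (\<Sum>X\<in>?S. pmf ?P X *
      measure_pmf.expectation (?step X) (\<lambda>X. real (card (isos X G))))"
    using fin_step finite_set_pmf_attachment_process
    by (subst pmf_expectation_bind[where A = ?S]) auto
  also have "\<dots> = (\<Sum>X\<in>?S. pmf ?P X *
      ((\<Sum>v\<in>verts G. real (card (isos X (delete_vertex v G))) /
        real (n choose card (neighbours G v))) / real (Suc n)))"
  proof (rule sum.cong[OF refl])
    fix X assume "X \<in> ?S"
    then have V: "verts X = {1..n}" and X: "simple_graph X"
      using set_pmf_attachment_process by auto
    show "pmf ?P X * measure_pmf.expectation (?step X) (\<lambda>X. real (card (isos X G))) =
      pmf ?P X * ((\<Sum>v\<in>verts G. real (card (isos X (delete_vertex v G))) /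
        real (n choose card (neighbours G v))) / real (Suc n))"
      using expectation_attachment_step[of "verts X" n "\<lambda>W. attach_vertex (Suc n) W X"
          "\<lambda>X. real (card (isos X G))"]
        sum_isos_attach_vertex[OF X G, of "Suc n" "\<lambda>k. real (n choose k)"]
      by (simp add: V)
  qed
  also have "\<dots> = (\<Sum>v\<in>verts G. (\<Sum>X\<in>?S. pmf ?P X * real (card (isos X (delete_vertex v G)))) /
        real (n choose card (neighbours G v))) / real (Suc n)"
    by (simp add: sum_distrib_left sum_divide_distrib sum.swap[of _ "verts G" ?S] algebra_simps)
  finally show ?thesis by (simp add: expected_isos_def expand)
qed

text \<open>The factor \<open>n = k + 1\<close> that separates \<open>n!\<close> from \<open>(n - 1)!\<close> cancels the probability \<open>1 / n\<close> of
  the size of the attachment set.\<close>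

theorem A_vertex_deletion:
  assumes G: "simple_graph G" and n: "card (verts G) \<ge> 2"
  shows "A G = (\<Sum>v\<in>verts G. A (delete_vertex v G) /
    real ((card (verts G) - 1) choose card (neighbours G v)))"
proof -
  have fin: "finite (verts G)" using G by (simp add: simple_graph_def)
  obtain k where k: "card (verts G) = Suc k" and k1: "k \<ge> 1"
    using n by (cases "card (verts G)") auto
  have "A (delete_vertex v G) = fact k * expected_isos k (delete_vertex v G)"
    if "v \<in> verts G" for v
    using that fin k by (simp add: A_eq_expected_isos)
  moreover have "A G = fact k * (real (Suc k) * expected_isos (Suc k) G)"
    using fin k by (simp add: A_eq_expected_isos algebra_simps)
  moreover have "real (Suc k) * expected_isos (Suc k) G = (\<Sum>v\<in>verts G.
      expected_isos k (delete_vertex v G) / real (k choose card (neighbours G v)))"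
    by (subst expected_isos_Suc[OF G k1]) (simp del: of_nat_Suc)
  ultimately show ?thesis by (simp add: k sum_distrib_left)
qed

text \<open>The recurrence above does not reach this case, as the process starts with one vertex.\<close>

lemma A_single_vertex:
  assumes "simple_graph G" and "card (verts G) = 1"
  shows "A G = 1"
proof -
  obtain v where v: "verts G = {v}" using assms(2) by (auto simp: card_1_singleton_iff)
  have nadj: "\<not> adjacent G v v" using simple_graph_adjacentD[OF assms(1)] by blast
  let ?K = "\<lparr>verts = {1::nat}, edges = {}\<rparr>"
  have "isos ?K G = {restrict (\<lambda>_. v) {1}}"
  proof (intro equalityI subsetI)
    fix f assume "f \<in> isos ?K G"
    then have "f \<in> extensional {1}" "f 1 = v" using v by (auto simp: isos_def bij_betw_def)
    then have "f = restrict (\<lambda>_. v) {1}" by (intro extensionalityI[of _ "{1}"]) auto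
    then show "f \<in> {restrict (\<lambda>_. v) {1}}" by simp
  next
    fix f assume "f \<in> {restrict (\<lambda>_. v) {1::nat}}"
    then show "f \<in> isos ?K G"
      using v nadj by (auto simp: isos_def adjacent_def bij_betw_def)
  qed
  then have "expected_isos 1 G = 1" by (simp add: expected_isos_def)
  then show ?thesis using assms v by (simp add: A_eq_expected_isos)
qed

section \<open>Blow-ups\<close>

lemma verts_blowup: "verts (blowup H m) = (SIGMA i:verts H. {..<m i})"
  by (simp add: blowup_def)

lemma adjacent_blowup:
  "adjacent (blowup H m) x y \<longleftrightarrow>
     x \<in> verts (blowup H m) \<and> y \<in> verts (blowup H m) \<and> adjacent H (fst x) (fst y)"
proof -
  have "adjacent (blowup H m) x y \<longleftrightarrow> (\<exists>i a j b. {x, y} = {(i, a), (j, b)} \<and>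
      i \<in> verts H \<and> j \<in> verts H \<and> a < m i \<and> b < m j \<and> adjacent H i j)"
    by (subst adjacent_def) (simp add: blowup_def)
  then show ?thesis
    by (cases x; cases y) (auto simp: doubleton_eq_iff verts_blowup adjacent_commute)
qed

lemma simple_graph_blowup:
  assumes "simple_graph H"
  shows "simple_graph (blowup H m)"
  using assms simple_graph_adjacentD(3)[OF assms]
  by (fastforce simp: simple_graph_def blowup_def card_insert_if)

lemma neighbours_blowup:
  assumes "x \<in> verts (blowup H m)"
  shows "neighbours (blowup H m) x = (SIGMA j:neighbours H (fst x). {..<m j})"
  using assms by (auto simp: neighbours_def adjacent_blowup verts_blowup)

text \<open>The vertices replacing \<open>i\<close> are twins. Swapping \<open>(i, a)\<close> with the last of them, \<open>(i, m i - 1)\<close>,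
  therefore moves the gap left by the deletion to the end of the index range.\<close>

lemma graph_iso_delete_vertex_blowup:
  assumes "(i, a) \<in> verts (blowup H m)"
  shows "graph_iso (delete_vertex (i, a) (blowup H m)) (blowup H (m(i := m i - 1)))"
proof -
  let ?t = "Transposition.transpose (i, a) (i, m i - 1)"
  let ?D = "delete_vertex (i, a) (blowup H m)" and ?B = "blowup H (m(i := m i - 1))"
  have a: "i \<in> verts H" "a < m i" using assms by (auto simp: verts_blowup)
  have fst: "fst (Transposition.transpose (i, a) (i, b) x) = fst x" for b x
    by (auto simp: Transposition.transpose_def)
  have "bij_betw ?t (verts ?D) (verts ?B)"
    using a by (intro bij_betw_byWitness[where f' = ?t])
      (auto simp: verts_blowup Transposition.transpose_def split: if_splits)
  moreover have "adjacent ?D x y \<longleftrightarrow> adjacent ?B (?t x) (?t y)"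
    if "x \<in> verts ?D" "y \<in> verts ?D" for x y
    using that bij_betwE[OF calculation]
    by (auto simp: adjacent_delete_vertex adjacent_blowup fst)
  ultimately show ?thesis unfolding graph_iso_def by blast
qed

theorem proposition11:
  fixes H :: "nat ugraph" and p n :: nat and m :: "nat \<Rightarrow> nat"
  assumes "simple_graph H" and "verts H = {1..p}"
    and "n = (\<Sum>i = 1..p. m i)"
  shows "(n = 1 \<longrightarrow> A (blowup H m) = 1) \<and>
    (n \<ge> 2 \<longrightarrow>
      A (blowup H m) =
        (\<Sum>i \<in> {i \<in> {1..p}. m i > 0}.
           real (m i) * A (blowup H (m(i := m i - 1))) /
           real ((n - 1) choose (\<Sum>j \<in> {j \<in> {1..p}. adjacent H i j}. m j))))"
proof (intro conjI impI)
  let ?B = "blowup H m"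
  have B: "simple_graph ?B" by (rule simple_graph_blowup[OF assms(1)])
  have cardB: "card (verts ?B) = n" by (simp add: verts_blowup assms)
  show "A ?B = 1" if "n = 1" using A_single_vertex[OF B] cardB that by simp
  assume n: "n \<ge> 2"
  let ?d = "\<lambda>i. \<Sum>j \<in> {j \<in> {1..p}. adjacent H i j}. m j"
  let ?term = "\<lambda>i. A (blowup H (m(i := m i - 1))) / real ((n - 1) choose ?d i)"
  have "A ?B = (\<Sum>x\<in>verts ?B. A (delete_vertex x ?B) /
      real ((n - 1) choose card (neighbours ?B x)))"
    using A_vertex_deletion[OF B] n cardB by simp
  also have "\<dots> = (\<Sum>(i, a)\<in>(SIGMA i:{1..p}. {..<m i}). ?term i)"
  proof (rule sum.cong)
    show "verts ?B = (SIGMA i:{1..p}. {..<m i})" by (simp add: verts_blowup assms)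
    fix x assume "x \<in> (SIGMA i:{1..p}. {..<m i})"
    then obtain i a where x: "x = (i, a)" "(i, a) \<in> verts ?B"
      by (auto simp: verts_blowup assms)
    have "A (delete_vertex x ?B) = A (blowup H (m(i := m i - 1)))"
      unfolding x(1) using graph_iso_delete_vertex_blowup[OF x(2)]
      by (rule A_cong_graph_iso) (simp_all add: verts_blowup assms)
    moreover have "card (neighbours ?B x) = ?d i"
      using neighbours_blowup[OF x(2)] by (simp add: x(1) neighbours_def assms)
    ultimately show "A (delete_vertex x ?B) / real ((n - 1) choose card (neighbours ?B x)) =
        (case x of (i, a) \<Rightarrow> ?term i)"
      by (simp add: x(1))
  qed
  also have "\<dots> = (\<Sum>i\<in>{1..p}. \<Sum>a<m i. ?term i)"
    by (rule sum.Sigma[symmetric]) auto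
  also have "\<dots> = (\<Sum>i \<in> {i \<in> {1..p}. m i > 0}. real (m i) * ?term i)"
    by (simp, rule sum.mono_neutral_right) auto
  finally show "A ?B = (\<Sum>i \<in> {i \<in> {1..p}. m i > 0}.
      real (m i) * A (blowup H (m(i := m i - 1))) / real ((n - 1) choose ?d i))"
    by simp
qed

end
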